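(* Let $n \geq 5$ and $1 \leq k \leq n-4$ be integers, and let $w(n,k)$ denote the number of compositions of $n$ with all parts in $\{1,2\}$ having capacity exactly $k$. Then $$w(n,k)=\sum_{r=1}^{\lfloor\frac{n-k-2}{2}\rfloor}(n-k-2r-1)\binom{k+r-1}{k}.$$
   Context: A composition of $n$ is a finite sequence of positive integers (parts) with sum $n$; $\mathcal{B}_n$ denotes the set of compositions of $n$ with all parts in $\{1,2\}$. The capacity $\mathrm{cap}(\pi)$ of a composition $\pi$ is the number of water cells of its bargraph (the unit cells outside the bargraph, whose $i$-th column has height $\pi_i$, that would hold water). For $\pi=\pi_1\cdots\pi_m\in\mathcal{B}_n$ this equals the number of indices $i$ with $\pi_i=1$ such that $\pi_a=2$ for some $a<i$ and $\pi_b=2$ for some $b>i$. Thus $w(n,k)=|\{\pi\in\mathcal{B}_n:\mathrm{cap}(\pi)=k\}|$. *)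

theory Defs
  imports Main
begin

definition compositions :: "nat \<Rightarrow> nat list set" where
  "compositions n = {p. (\<forall>x\<in>set p. 0 < x) \<and> sum_list p = n}"

definition compositions12 :: "nat \<Rightarrow> nat list set" where
  "compositions12 n = {p \<in> compositions n. set p \<subseteq> {1, 2}}"

text \<open>
  The pair \<open>(i, h)\<close> stands for the unit cell in column \<open>i\<close> (counted from 0) between heights
  \<open>h - 1\<close> and \<open>h\<close>. Such a cell holds water iff it lies above column \<open>i\<close> and is bounded
  on both sides by columns of height at least \<open>h\<close>.
\<close>

definition water_cells :: "nat list \<Rightarrow> (nat \<times> nat) set" where
  "water_cells p = {(i, h). i < length p \<and> p ! i < h \<and>
     (\<exists>a. a < i \<and> h \<le> p ! a) \<and> (\<exists>b. i < b \<and> b < length p \<and> h \<le> p ! b)}"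

definition capacity :: "nat list \<Rightarrow> nat" where
  "capacity p = card (water_cells p)"

definition w :: "nat \<Rightarrow> nat \<Rightarrow> nat" where
  "w n k = card {p \<in> compositions12 n. capacity p = k}"

lemma finite_compositions12: "finite (compositions12 n)"
proof (rule finite_subset)
  have "length p \<le> sum_list p" if "\<forall>x\<in>set p. 0 < x" for p :: "nat list"
    using that by (induction p) auto
  then show "compositions12 n \<subseteq> {p. set p \<subseteq> {1, 2} \<and> length p \<le> n}"
    by (auto simp: compositions12_def compositions_def)
  show "finite {p. set p \<subseteq> {1, 2::nat} \<and> length p \<le> n}"
    by (rule finite_lists_length_le) simp
qed

lemma finite_water_cells: "finite (water_cells p)"
proof (rule finite_subset)
  show "water_cells p \<subseteq> {..<length p} \<times> {..sum_list p}"
    by (auto simp: water_cells_def) (meson elem_le_sum_list le_trans)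
qed simp

lemma capacity_compositions12:
  assumes "p \<in> compositions12 n"
  shows "capacity p = card {i. i < length p \<and> p ! i = 1 \<and>
    (\<exists>a<i. p ! a = 2) \<and> (\<exists>b. i < b \<and> b < length p \<and> p ! b = 2)}" (is "_ = card ?I")
proof -
  have *: "p ! i = 1 \<or> p ! i = 2" if "i < length p" for i
    using assms nth_mem[OF that] unfolding compositions12_def by blast
  have "water_cells p = (\<lambda>i. (i, 2::nat)) ` ?I"
  proof (intro set_eqI iffI)
    fix c assume c: "c \<in> water_cells p"
    obtain i h where ih: "c = (i, h)" by fastforce
    with c obtain a b where ab: "i < length p" "p ! i < h" "a < i" "h \<le> p ! a"
      "i < b" "b < length p" "h \<le> p ! b"
      by (auto simp: water_cells_def)
    then have "a < length p" by simp
    with *[of i] *[of a] *[of b] ab have "h = 2" "p ! i = 1" "p ! a = 2" "p ! b = 2"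
      by auto
    with ab ih show "c \<in> (\<lambda>i. (i, 2::nat)) ` ?I" by auto
  next
    fix c assume "c \<in> (\<lambda>i. (i, 2::nat)) ` ?I"
    then show "c \<in> water_cells p"
      by (auto simp: water_cells_def)
  qed
  then show ?thesis
    by (simp add: capacity_def card_image inj_on_def)
qed

end

theory Submission
  imports Defs "HOL-Combinatorics.Multiset_Permutations"
begin

text \<open>
  Ones hold water exactly when they lie strictly between the first and the last two. A word
  over \<open>{1, 2}\<close> of positive capacity therefore contains at least two twos, and cutting it at
  the first and the last of them writes it in a unique way as
  \<open>1\<dots>1 2 q 2 1\<dots>1\<close> (\<open>two_twos_decomp\<close>, \<open>pad_inject\<close>). Its capacity is the number of ones
  in \<open>q\<close> (\<open>capacity_pad\<close>).

  Let \<open>r + 1\<close> be the total number of twos. Then \<open>q\<close> has \<open>k\<close> ones and \<open>r - 1\<close> twos, which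
  leaves \<open>(k + r - 1) choose k\<close> choices (\<open>card_words12\<close>). The remaining weight
  \<open>n - k - 2 * r - 2\<close> consists of dry ones, and it is distributed over the two ends in
  \<open>n - k - 2 * r - 1\<close> ways. Summing the product over \<open>r\<close> gives the formula; the
  largest \<open>r\<close> is the one that leaves at most a single dry one.
\<close>

definition words12 :: "nat \<Rightarrow> nat \<Rightarrow> nat list set" where
  "words12 k s = {q. set q \<subseteq> {1, 2} \<and> count_list q 1 = k \<and> count_list q 2 = s}"

definition pad :: "nat \<Rightarrow> nat list \<Rightarrow> nat \<Rightarrow> nat list" where
  "pad a q b = replicate a 1 @ 2 # q @ 2 # replicate b 1"

text \<open>The words are the arrangements of one fixed multiset, so a multinomial coefficient counts them.\<close>

lemma words12_eq_permutations:
  "words12 k s = permutations_of_multiset (replicate_mset k 1 + replicate_mset s 2)"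
proof (intro set_eqI iffI)
  fix q assume q: "q \<in> words12 k s"
  have "mset q = replicate_mset k 1 + replicate_mset s 2"
  proof (rule multiset_eqI)
    fix x
    have "count (mset q) x = 0" if "x \<noteq> 1" "x \<noteq> 2"
      using q that by (auto simp: words12_def count_eq_zero_iff)
    with q show "count (mset q) x = count (replicate_mset k 1 + replicate_mset s 2) x"
      by (auto simp: words12_def count_mset)
  qed
  then show "q \<in> permutations_of_multiset (replicate_mset k 1 + replicate_mset s 2)"
    by (simp add: permutations_of_multiset_def)
next
  fix q :: "nat list"
  assume "q \<in> permutations_of_multiset (replicate_mset k 1 + replicate_mset s 2)"
  then have m: "mset q = replicate_mset k 1 + replicate_mset s 2"
    by (simp add: permutations_of_multiset_def)
  from arg_cong[OF m, of set_mset] have "set q \<subseteq> {1, 2}"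
    by (auto split: if_splits)
  moreover have "count_list q 1 = k" "count_list q 2 = s"
    using m by (simp_all flip: count_mset)
  ultimately show "q \<in> words12 k s"
    by (simp add: words12_def)
qed

lemma finite_words12: "finite (words12 k s)"
  by (simp add: words12_eq_permutations)

lemma card_words12: "card (words12 k s) = (k + s) choose k"
proof -
  let ?A = "replicate_mset k 1 + replicate_mset s (2::nat)"
  have "(\<Prod>x\<in>set_mset ?A. fact (count ?A x)) = (\<Prod>x\<in>{1, 2}. fact (count ?A x) :: nat)"
    by (rule prod.mono_neutral_left) (auto simp: count_eq_zero_iff)
  also have "\<dots> = fact k * fact s"
    by simp
  finally show ?thesis
    by (simp add: words12_eq_permutations card_permutations_of_multiset binomial_fact')
qed

lemma sum_list_12:
  assumes "set p \<subseteq> {1, 2::nat}"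
  shows "sum_list p = count_list p 1 + 2 * count_list p 2"
  using assms by (induction p) auto

lemma compositions12_iff:
  "p \<in> compositions12 n \<longleftrightarrow> set p \<subseteq> {1, 2} \<and> sum_list p = n"
  by (auto simp: compositions12_def compositions_def)

lemma pad_in_compositions12_iff:
  assumes "q \<in> words12 k s"
  shows "pad a q b \<in> compositions12 n \<longleftrightarrow> n = a + b + k + 2 * s + 4"
  using assms sum_list_12[of q]
  by (auto simp: compositions12_iff pad_def words12_def sum_list_replicate)

text \<open>The two marked twos enclose exactly the positions of \<open>q\<close>, shifted by \<open>a + 1\<close>.\<close>

lemma capacity_pad:
  assumes "set q \<subseteq> {1, 2}"
  shows "capacity (pad a q b) = count_list q 1"
proof -
  let ?p = "pad a q b"
  let ?I = "{i. i < length ?p \<and> ?p ! i = 1 \<and>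
    (\<exists>a<i. ?p ! a = 2) \<and> (\<exists>b. i < b \<and> b < length ?p \<and> ?p ! b = 2)}"
  let ?l = "length q"
  have len: "length ?p = a + ?l + b + 2"
    by (simp add: pad_def)
  have left: "?p ! i = 1" if "i < a" for i
    using that by (simp add: pad_def nth_append)
  have first: "?p ! a = 2"
    by (simp add: pad_def nth_append)
  have mid: "?p ! (a + 1 + j) = q ! j" if "j < ?l" for j
    using that by (simp add: pad_def nth_append)
  have last: "?p ! (a + 1 + ?l) = 2"
    by (simp add: pad_def nth_append)
  have right: "?p ! i = 1" if "a + 1 + ?l < i" "i < length ?p" for i
  proof -
    have "i = a + ?l + 2 + (i - (a + ?l + 2))" "i - (a + ?l + 2) < b"
      using that len by linarith+
    moreover have "?p ! (a + ?l + 2 + j) = 1" if "j < b" for j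
      using that by (simp add: pad_def nth_append)
    ultimately show ?thesis
      by metis
  qed
  have "?I = (\<lambda>j. a + 1 + j) ` {j. j < ?l \<and> q ! j = 1}"
  proof (intro set_eqI iffI)
    fix i assume "i \<in> ?I"
    then obtain c d where i: "?p ! i = 1" and c: "c < i" "?p ! c = 2"
      and d: "i < d" "d < length ?p" "?p ! d = 2"
      by auto
    have "a < i"
      using c left[of c] by (cases "c < a") auto
    moreover have "i < a + 1 + ?l"
      using d right[of d] by (cases "a + 1 + ?l < d") auto
    ultimately obtain j where "i = a + 1 + j" "j < ?l"
      by (metis Suc_eq_plus1 Suc_leI add_less_cancel_left le_iff_add)
    with i mid[of j] show "i \<in> (\<lambda>j. a + 1 + j) ` {j. j < ?l \<and> q ! j = 1}"
      by auto
  next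
    fix i assume "i \<in> (\<lambda>j. a + 1 + j) ` {j. j < ?l \<and> q ! j = 1}"
    then obtain j where j: "i = a + 1 + j" "j < ?l" "q ! j = 1"
      by auto
    have "\<exists>c<i. ?p ! c = 2"
      using j first by (intro exI[of _ a]) simp
    moreover have "\<exists>d. i < d \<and> d < length ?p \<and> ?p ! d = 2"
      using j last len by (intro exI[of _ "a + 1 + ?l"]) simp
    ultimately show "i \<in> ?I"
      using j mid[of j] len by simp
  qed
  then have "card ?I = card {j. j < ?l \<and> q ! j = 1}"
    by (simp add: card_image inj_on_def)
  also have "\<dots> = count_list q 1"
    by (simp add: count_list_eq_length_filter length_filter_conv_card eq_commute)
  finally have "card ?I = count_list q 1" .
  moreover have "?p \<in> compositions12 (sum_list ?p)"
    using assms by (auto simp: compositions12_iff pad_def)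
  ultimately show ?thesis
    by (simp add: capacity_compositions12)
qed

text \<open>Both outer runs avoid the letter 2, so the two cuts can be read off from the word.\<close>

lemma pad_inject: "pad a q b = pad a' q' b' \<longleftrightarrow> a = a' \<and> q = q' \<and> b = b'"
proof
  assume eq: "pad a q b = pad a' q' b'"
  have pre: "takeWhile (\<lambda>x. x = 1) (pad c u d) = replicate c 1" for c u d
    by (simp add: pad_def takeWhile_append)
  have suf: "takeWhile (\<lambda>x. x = 1) (rev (pad c u d)) = replicate d 1" for c u d
    by (simp add: pad_def takeWhile_append)
  have "a = a'"
    using pre[of a q b] pre[of a' q' b'] eq by (metis length_replicate)
  moreover have "b = b'"
    using suf[of a q b] suf[of a' q' b'] eq by (metis length_replicate)
  ultimately show "a = a' \<and> q = q' \<and> b = b'"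
    using eq by (simp add: pad_def)
qed simp

lemma ones_eq_replicate:
  assumes "set u \<subseteq> {1, 2::nat}" "2 \<notin> set u"
  shows "u = replicate (length u) 1"
  using assms by (intro replicate_eqI) auto

lemma two_twos_decomp:
  assumes "set p \<subseteq> {1, 2}" and "i < j" "j < length p" "p ! i = 2" "p ! j = 2"
  obtains a q b where "p = pad a q b" "set q \<subseteq> {1, 2}"
proof -
  have "2 \<in> set p"
    using assms by (metis nth_mem)
  then obtain u v where uv: "p = u @ 2 # v" "2 \<notin> set u"
    by (metis split_list_first)
  have "length u \<le> i"
  proof (rule ccontr)
    assume "\<not> length u \<le> i"
    then have "p ! i \<in> set u"
      by (simp add: uv nth_append)
    with assms uv show False
      by simp
  qed
  then have "v ! (j - length u - 1) = 2" "j - length u - 1 < length v"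
    using assms uv by (auto simp: nth_append nth_Cons')
  then have "2 \<in> set v"
    by (metis nth_mem)
  then obtain q t where qt: "v = q @ 2 # t" "2 \<notin> set t"
    by (metis split_list_last)
  have sub: "set u \<subseteq> {1, 2}" "set q \<subseteq> {1, 2}" "set t \<subseteq> {1, 2}"
    using uv qt assms(1) by auto
  have "p = pad (length u) q (length t)"
    unfolding pad_def
    using uv(1) qt(1) ones_eq_replicate[OF sub(1) uv(2)] ones_eq_replicate[OF sub(3) qt(2)]
    by metis
  with sub(2) show ?thesis
    using that by blast
qed

lemma positive_capacity_decomp:
  assumes p: "p \<in> compositions12 n" and "0 < capacity p"
  obtains a q b where "p = pad a q b" "set q \<subseteq> {1, 2}"
proof -
  from assms obtain i a b where "a < i" "p ! a = 2" "i < b" "b < length p" "p ! b = 2"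
    by (auto simp: capacity_compositions12 card_gt_0_iff)
  with p have "set p \<subseteq> {1, 2}" "a < b"
    by (simp_all add: compositions12_iff)
  with \<open>p ! a = 2\<close> \<open>b < length p\<close> \<open>p ! b = 2\<close> show ?thesis
    using two_twos_decomp that by blast
qed

theorem theorem1:
  fixes n k :: nat
  assumes "5 \<le> n" and "1 \<le> k" and "k \<le> n - 4"
  shows "int (w n k) =
    (\<Sum>r = 1..(n - k - 2) div 2. (int n - int k - 2 * int r - 1) * int ((k + r - 1) choose k))"
proof -
  let ?R = "{1..(n - k - 2) div 2}"
  let ?D = "SIGMA r:?R. {..n - k - 2 * r - 2} \<times> words12 k (r - 1)"
  let ?f = "\<lambda>(r, a, q). pad a q (n - k - 2 * r - 2 - a)"
  have R: "1 \<le> r" "2 * r + k + 2 \<le> n" if "r \<in> ?R" for r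
    using that assms by auto
  have inj: "inj_on ?f ?D"
  proof (rule inj_onI)
    fix x y assume xy: "x \<in> ?D" "y \<in> ?D" "?f x = ?f y"
    obtain r a q r' a' q' where e: "x = (r, a, q)" "y = (r', a', q')"
      by (metis prod_cases3)
    with xy have "a = a'" "q = q'"
      by (auto simp: pad_inject)
    \<comment> \<open>The number of twos in the middle word determines \<open>r\<close>.\<close>
    moreover from this xy e have "r - 1 = r' - 1" "r \<in> ?R" "r' \<in> ?R"
      by (auto simp: words12_def)
    moreover from this have "r = r'"
      using R(1)[of r] R(1)[of r'] by linarith
    ultimately show "x = y"
      using e by simp
  qed
  have img: "?f ` ?D = {p \<in> compositions12 n. capacity p = k}"
  proof (intro set_eqI iffI)
    fix p assume "p \<in> ?f ` ?D"
    then obtain r a q where *: "r \<in> ?R" "a \<le> n - k - 2 * r - 2" "q \<in> words12 k (r - 1)"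
      "p = pad a q (n - k - 2 * r - 2 - a)"
      by auto
    have "n = a + (n - k - 2 * r - 2 - a) + k + 2 * (r - 1) + 4"
      using R[OF *(1)] *(2) by linarith
    then have "p \<in> compositions12 n"
      using * by (simp only: pad_in_compositions12_iff[OF *(3)])
    with * show "p \<in> {p \<in> compositions12 n. capacity p = k}"
      by (simp add: capacity_pad words12_def)
  next
    fix p assume "p \<in> {p \<in> compositions12 n. capacity p = k}"
    then have p: "p \<in> compositions12 n" "capacity p = k"
      by auto
    with assms obtain a q b where q: "p = pad a q b" "set q \<subseteq> {1, 2}"
      using positive_capacity_decomp[of p n] by auto
    define r where "r = count_list q 2 + 1"
    have qw: "q \<in> words12 k (r - 1)"
      using p q by (simp add: words12_def r_def capacity_pad)
    then have n: "n = a + b + k + 2 * (r - 1) + 4"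
      using p(1) q(1) by (simp add: pad_in_compositions12_iff)
    have "1 \<le> r"
      by (simp add: r_def)
    then have "n - k - 2 * r - 2 = a + b" "r \<in> ?R"
      using n by auto
    then have "p = ?f (r, a, q)" "(r, a, q) \<in> ?D"
      using q(1) qw by (simp_all del: diff_diff_left)
    then show "p \<in> ?f ` ?D"
      by (rule image_eqI)
  qed
  have "w n k = card ?D"
    unfolding w_def img[symmetric] by (rule card_image[OF inj])
  also have "\<dots> = (\<Sum>r\<in>?R. (n - k - 2 * r - 2 + 1) * ((k + (r - 1)) choose k))"
    by (simp add: finite_words12 card_words12 card_cartesian_product)
  finally have "int (w n k)
      = (\<Sum>r\<in>?R. int ((n - k - 2 * r - 2 + 1) * ((k + (r - 1)) choose k)))"
    by simp
  also have "\<dots> = (\<Sum>r\<in>?R. (int n - int k - 2 * int r - 1) * int ((k + r - 1) choose k))"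
  proof (rule sum.cong)
    fix r assume "r \<in> ?R"
    with R[of r] have "k + (r - 1) = k + r - 1"
      "int (n - k - 2 * r - 2 + 1) = int n - int k - 2 * int r - 1"
      by auto
    then show "int ((n - k - 2 * r - 2 + 1) * ((k + (r - 1)) choose k))
        = (int n - int k - 2 * int r - 1) * int ((k + r - 1) choose k)"
      by (simp only: of_nat_mult)
  qed simp
  finally show ?thesis .
qed

end
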